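(* For every $k\in\mathbb Z$ the relation $\preceq_k$ is a partial order on the set $\mathcal O$ of all multisegments.
   Context: A segment is $\Delta=[i,j]=\{i,\dots,j\}$ with integers $i\le j$; $e(\Delta)=j$. A multisegment is a finite multiset of segments; empty segments are discarded. Two segments are linked if neither contains the other and their union is a segment. $\mathbf b\le\mathbf a$ means that $\mathbf b$ is obtained from $\mathbf a$ by a (possibly empty) series of elementary operations, each replacing a linked pair $\{\Delta,\Delta'\}$ by $\{\Delta\cup\Delta',\Delta\cap\Delta'\}$. For a multisegment $\mathbf a$ let $\mathbf a(k)$ be the multiset of $\Delta\in\mathbf a$ with $e(\Delta)=k$. For a sub-multiset $\Gamma\subseteq\mathbf a(k)$ let $\mathbf a_\Gamma$ be the multisegment obtained from $\mathbf a$ by replacing each segment $[i,k]\in\Gamma$ by $[i,k-1]$ (deleting it if $i=k$). Write $\mathbf b\preceq_k\mathbf a$ if $\mathbf b\le\mathbf a_\Gamma$ for some (possibly empty) $\Gamma\subseteq\mathbf a(k)$. *)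

theory Defs
  imports Main "HOL-Library.Multiset"
begin

text \<open>Segments are finite nonempty integer intervals, as sets of integers.\<close>

definition is_segment :: "int set \<Rightarrow> bool" where
  "is_segment D \<longleftrightarrow> (\<exists>i j. i \<le> j \<and> D = {i..j})"

text \<open>The end point of a segment; meaningful only on nonempty finite sets.\<close>

definition seg_end :: "int set \<Rightarrow> int" where
  "seg_end D = Max D"

definition multisegments :: "int set multiset set" where
  "multisegments = {a. \<forall>D \<in># a. is_segment D}"

definition discard_empty :: "int set multiset \<Rightarrow> int set multiset" where
  "discard_empty a = filter_mset (\<lambda>D. D \<noteq> {}) a"

definition linked :: "int set \<Rightarrow> int set \<Rightarrow> bool" where
  "linked D E \<longleftrightarrow> is_segment D \<and> is_segment E \<and>
     \<not> D \<subseteq> E \<and> \<not> E \<subseteq> D \<and> is_segment (D \<union> E)"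

text \<open>\<open>elementary_op b a\<close>: the multisegment \<open>b\<close> results from \<open>a\<close> by one elementary
  operation (the smaller multisegment comes first).\<close>

definition elementary_op :: "int set multiset \<Rightarrow> int set multiset \<Rightarrow> bool" where
  "elementary_op b a \<longleftrightarrow> (\<exists>D E. linked D E \<and> {#D, E#} \<subseteq># a \<and>
     b = (a - {#D, E#}) + discard_empty {#D \<union> E, D \<inter> E#})"

definition mseg_le :: "int set multiset \<Rightarrow> int set multiset \<Rightarrow> bool" where
  "mseg_le = elementary_op\<^sup>*\<^sup>*"

definition ending_at :: "int set multiset \<Rightarrow> int \<Rightarrow> int set multiset" where
  "ending_at a k = filter_mset (\<lambda>D. seg_end D = k) a"

text \<open>The segment \<open>{i..j}\<close> is sent to \<open>{i..j - 1}\<close>, which is empty if \<open>i = j\<close>.\<close>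

definition shorten :: "int set \<Rightarrow> int set" where
  "shorten D = {Min D..seg_end D - 1}"

definition truncate :: "int set multiset \<Rightarrow> int set multiset \<Rightarrow> int set multiset" where
  "truncate a G = (a - G) + discard_empty (image_mset shorten G)"

definition trunc_le :: "int \<Rightarrow> int set multiset \<Rightarrow> int set multiset \<Rightarrow> bool" where
  "trunc_le k b a \<longleftrightarrow> (\<exists>G. G \<subseteq># ending_at a k \<and> mseg_le b (truncate a G))"

end

theory Submission
  imports Defs
begin

text \<open>Reflexivity is the case of an empty \<open>\<Gamma>\<close>.

  For transitivity the point is that truncation can be pushed through an elementary operation:
  if \<open>b \<le> a\<close> and \<open>\<Gamma> \<subseteq> b(k)\<close>, then there is \<open>\<Gamma>' \<subseteq> a(k)\<close> with \<open>b\<^sub>\<Gamma> \<le> a\<^sub>\<Gamma>\<^sub>'\<close>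
  (\<open>truncate_elementary_op\<close>, \<open>truncate_mseg_le\<close>). If a single operation replaces \<open>[i,j], [p,q]\<close>
  by \<open>[i,q], [p,j]\<close>, where \<open>i < p\<close> and \<open>j < q\<close>, then a truncated \<open>[i,q]\<close> with \<open>q = k\<close> is matched
  by truncating \<open>[p,q]\<close>, and a truncated \<open>[p,j]\<close> with \<open>j = k\<close> by truncating \<open>[i,j]\<close>. Afterwards
  the same exchange of end points is again an elementary operation, or leaves the multisegment
  unchanged. As truncated segments no longer end at \<open>k\<close>, two successive truncations amount
  to a single one (\<open>truncate_truncate\<close>).

  For antisymmetry, the sum of the lengths of the segments is invariant under elementary
  operations and drops strictly under a nontrivial truncation, so a cycle involves no truncation.
  The sum of the squared lengths strictly grows under an elementary operation, so a
  cycle involves no operation either.\<close>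

section \<open>Elementary operations in terms of end points\<close>

lemma is_segment_Icc_iff [simp]: "is_segment {i..j} \<longleftrightarrow> i \<le> j"
  unfolding is_segment_def by auto

lemma discard_empty_empty [simp]: "discard_empty {#} = {#}"
  by (simp add: discard_empty_def)

lemma discard_empty_union [simp]: "discard_empty (a + b) = discard_empty a + discard_empty b"
  by (simp add: discard_empty_def)

lemma discard_empty_add_mset [simp]:
  "discard_empty (add_mset D a) = (if D = {} then discard_empty a else add_mset D (discard_empty a))"
  by (simp add: discard_empty_def)

text \<open>Adjacent segments, \<open>p = j + 1\<close>, are linked as well; then \<open>{p..j}\<close> is the empty
  intersection.\<close>

lemma linked_cases:
  assumes "linked D E"
  obtains i j p q where "i \<le> j" "i < p" "p \<le> j + 1" "j < q"
    "{#D, E#} = {#{i..j}, {p..q}#}" "D \<union> E = {i..q}" "D \<inter> E = {p..j}"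
proof -
  have ordered: "\<exists>i j p q. i \<le> j \<and> i < p \<and> p \<le> j + 1 \<and> j < q \<and> A = {i..j} \<and> B = {p..q} \<and>
      A \<union> B = {i..q} \<and> A \<inter> B = {p..j}"
    if AB: "A = {i..j}" "B = {p..q}" "i \<le> j" "p \<le> q" "\<not> A \<subseteq> B" "\<not> B \<subseteq> A"
      "is_segment (A \<union> B)" "i \<le> p"
    for A B :: "int set" and i j p q
  proof -
    have 1: "i < p" "j < q" using AB by auto
    have 2: "p \<le> j + 1"
    proof (rule ccontr)
      assume gap: "\<not> p \<le> j + 1"
      obtain u v where uv: "A \<union> B = {u..v}" using AB(7) unfolding is_segment_def by blast
      have "i \<in> {u..v}" "q \<in> {u..v}" using AB(1-4) unfolding uv [symmetric] by auto
      then have "j + 1 \<in> {u..v}" using AB(3,4) gap by auto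
      then show False using AB(1,2) gap unfolding uv [symmetric] by auto
    qed
    have "A \<union> B = {i..q}" "A \<inter> B = {p..j}" using 1 2 AB(1-4) by auto
    then show ?thesis using 1 2 AB(1-3) by blast
  qed
  obtain i j p q where *: "D = {i..j}" "E = {p..q}" "i \<le> j" "p \<le> q"
    using assms unfolding linked_def is_segment_def by blast
  have **: "\<not> D \<subseteq> E" "\<not> E \<subseteq> D" "is_segment (D \<union> E)"
    using assms unfolding linked_def by auto
  show thesis
  \<comment> \<open>\<open>linked\<close> is symmetric, so either segment may be the one that starts first.\<close>
  proof (cases "i \<le> p")
    case True
    from ordered [OF * ** True] show thesis using that by blast
  next
    case False
    have "is_segment (E \<union> D)" "p \<le> i" using **(3) False by (auto simp: Un_commute)
    from ordered [OF *(2,1,4,3) **(2,1) this]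
    obtain i j p q where "i \<le> j" "i < p" "p \<le> j + 1" "j < q" "E = {i..j}" "D = {p..q}"
      "E \<union> D = {i..q}" "E \<inter> D = {p..j}" by blast
    then show thesis
      by (intro that [of i j p q]) (simp_all add: Un_commute Int_commute add_mset_commute)
  qed
qed

lemma elementary_op_cases:
  assumes "elementary_op b a"
  obtains r i j p q where "i \<le> j" "i < p" "p \<le> j + 1" "j < q"
    "a = r + {#{i..j}, {p..q}#}" "b = r + discard_empty {#{i..q}, {p..j}#}"
proof -
  obtain D E where DE: "linked D E" "{#D, E#} \<subseteq># a"
    and b: "b = (a - {#D, E#}) + discard_empty {#D \<union> E, D \<inter> E#}"
    using assms unfolding elementary_op_def by blast
  from DE(1) obtain i j p q where *: "i \<le> j" "i < p" "p \<le> j + 1" "j < q"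
    "{#D, E#} = {#{i..j}, {p..q}#}" "D \<union> E = {i..q}" "D \<inter> E = {p..j}"
    by (rule linked_cases)
  have "a = (a - {#D, E#}) + {#{i..j}, {p..q}#}"
    using DE(2) unfolding *(5) by (rule subset_mset.diff_add [symmetric])
  from that [OF *(1-4) this] b show thesis unfolding *(6,7) by blast
qed

lemma elementary_opI:
  assumes "i \<le> j" "i < p" "p \<le> j + 1" "j < q"
  shows "elementary_op (r + discard_empty {#{i..q}, {p..j}#}) (r + {#{i..j}, {p..q}#})"
proof -
  have U: "{i..j} \<union> {p..q} = {i..q}" and I: "{i..j} \<inter> {p..q} = {p..j}" using assms by auto
  have "linked {i..j} {p..q}" using assms unfolding linked_def U by auto
  moreover have "r + M - M = r" "M \<subseteq># r + M" for M :: "int set multiset"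
    by simp_all
  ultimately show ?thesis
    unfolding elementary_op_def by (metis U I)
qed

section \<open>Truncation\<close>

lemma seg_end_Icc [simp]: "i \<le> j \<Longrightarrow> seg_end {i..j} = j"
  unfolding seg_end_def by (rule Max_eqI) auto

lemma shorten_Icc [simp]: "i \<le> j \<Longrightarrow> shorten {i..j} = {i..j - 1}"
proof -
  assume "i \<le> j"
  moreover from this have "Min {i..j} = i" by (intro Min_eqI) auto
  ultimately show ?thesis by (simp add: shorten_def)
qed

lemma ending_at_union [simp]: "ending_at (a + b) k = ending_at a k + ending_at b k"
  by (simp add: ending_at_def)

lemma ending_at_subset: "ending_at a k \<subseteq># a"
  by (simp add: ending_at_def)

lemma subset_ending_at_iff: "G \<subseteq># ending_at a k \<longleftrightarrow> G \<subseteq># a \<and> (\<forall>D \<in># G. seg_end D = k)"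
proof
  assume "G \<subseteq># ending_at a k"
  then show "G \<subseteq># a \<and> (\<forall>D \<in># G. seg_end D = k)"
    using ending_at_subset by (auto simp: ending_at_def dest: mset_subset_eqD intro: subset_mset.trans)
next
  assume *: "G \<subseteq># a \<and> (\<forall>D \<in># G. seg_end D = k)"
  then have "filter_mset (\<lambda>D. seg_end D = k) G \<subseteq># ending_at a k"
    unfolding ending_at_def by (intro multiset_filter_mono) auto
  moreover have "filter_mset (\<lambda>D. seg_end D = k) G = G" using * by (simp add: filter_mset_eq_conv)
  ultimately show "G \<subseteq># ending_at a k" by simp
qed

lemma truncate_empty [simp]: "truncate a {#} = a"
  by (simp add: truncate_def)

lemma truncate_union:
  assumes "G \<subseteq># a" "H \<subseteq># b"
  shows "truncate (a + b) (G + H) = truncate a G + truncate b H"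
proof -
  have "(a + b) - (G + H) = (a - G) + (b - H)"
    using assms by (auto simp: mset_subset_eq_exists_conv)
  then show ?thesis by (simp add: truncate_def ac_simps)
qed

lemma ending_at_truncate:
  assumes "G \<subseteq># ending_at a k"
  shows "ending_at (truncate a G) k = ending_at a k - G"
proof -
  have end_G: "seg_end D = k" if "D \<in># G" for D
    using assms that by (simp add: subset_ending_at_iff)
  have "seg_end S \<noteq> k" if "S \<in># discard_empty (image_mset shorten G)" for S
  proof -
    from that obtain D where D: "D \<in># G" "S = shorten D" "S \<noteq> {}"
      by (auto simp: discard_empty_def)
    then show ?thesis using end_G by (auto simp: shorten_def)
  qed
  then have "ending_at (discard_empty (image_mset shorten G)) k = {#}"
    by (auto simp: ending_at_def filter_mset_eq_conv)
  moreover have "filter_mset (\<lambda>D. seg_end D = k) G = G"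
    using end_G by (simp add: filter_mset_eq_conv)
  then have "ending_at (a - G) k = ending_at a k - G"
    by (simp add: ending_at_def filter_diff_mset)
  ultimately show ?thesis by (simp add: truncate_def)
qed

text \<open>Segments shortened by the first truncation do not end at \<open>k\<close> any more, so the second one
  only affects segments that were left untouched.\<close>

lemma truncate_truncate:
  assumes G: "G \<subseteq># ending_at a k" and H: "H \<subseteq># ending_at (truncate a G) k"
  shows "G + H \<subseteq># ending_at a k" and "truncate (truncate a G) H = truncate a (G + H)"
proof -
  have H': "H \<subseteq># ending_at a k - G" using H ending_at_truncate [OF G] by simp
  then show GH: "G + H \<subseteq># ending_at a k"
    using G by (metis add.commute subset_eq_diff_conv subset_mset.le_diff_conv2)
  have "G + H \<subseteq># a" using GH ending_at_subset by (rule subset_mset.trans)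
  then obtain c where a: "a = G + H + c" by (auto simp: mset_subset_eq_exists_conv)
  show "truncate (truncate a G) H = truncate a (G + H)"
    by (simp add: truncate_def a ac_simps)
qed

section \<open>Truncation is compatible with elementary operations\<close>

lemma subset_mset_unionE:
  assumes "G \<subseteq># a + b"
  obtains G1 G2 where "G = G1 + G2" "G1 \<subseteq># a" "G2 \<subseteq># b"
proof (rule that)
  show "G = G \<inter># a + (G - a)" by (rule multiset_eqI) (simp add: min_def)
  show "G \<inter># a \<subseteq># a" by simp
  show "G - a \<subseteq># b" using assms by (simp add: subset_eq_diff_conv add.commute)
qed

text \<open>This is the core of the transitivity proof, for the two segments that the operation changes;
  \<open>r\<close> stands for the rest of the multisegment. Since \<open>j < q\<close>, at most one of the new segments
  ends at \<open>k\<close>, so \<open>H\<close> is empty or a singleton.\<close>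

lemma truncate_exchange:
  assumes le: "i \<le> j" "i < p" "p \<le> j + 1" "j < q"
    and H: "H \<subseteq># ending_at (discard_empty {#{i..q}, {p..j}#}) k"
  shows "\<exists>H'. H' \<subseteq># ending_at {#{i..j}, {p..q}#} k \<and>
    (\<forall>r. mseg_le (r + truncate (discard_empty {#{i..q}, {p..j}#}) H)
                 (r + truncate {#{i..j}, {p..q}#} H'))"
proof (cases "H = {#}")
  case True
  have "mseg_le (r + discard_empty {#{i..q}, {p..j}#}) (r + {#{i..j}, {p..q}#})" for r
    unfolding mseg_le_def by (rule r_into_rtranclp, rule elementary_opI) (use le in auto)
  then show ?thesis using True by (intro exI [of _ "{#}"]) simp
next
  case False
  consider "q = k" "H = {#{i..q}#}" | "j = k" "p \<le> j" "H = {#{p..j}#}"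
    using H False le nonempty_subseteq_mset_eq_single [OF False]
    unfolding ending_at_def by (auto split: if_splits)
  then show ?thesis
  proof cases
    case 1
    have sub: "{#{p..q}#} \<subseteq># ending_at {#{i..j}, {p..q}#} k"
      using 1 le by (simp add: ending_at_def)
    have new: "truncate (discard_empty {#{i..q}, {p..j}#}) H
        = discard_empty {#{i..q - 1}, {p..j}#}"
      using 1 le by (auto simp: truncate_def)
    have old: "truncate {#{i..j}, {p..q}#} {#{p..q}#} = discard_empty {#{i..j}, {p..q - 1}#}"
      using 1 le by (auto simp: truncate_def)
    have "mseg_le (r + discard_empty {#{i..q - 1}, {p..j}#})
        (r + discard_empty {#{i..j}, {p..q - 1}#})" for r
    proof (cases "j < q - 1")
      case True
      then have "discard_empty {#{i..j}, {p..q - 1}#} = {#{i..j}, {p..q - 1}#}" using le by simp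
      then show ?thesis using elementary_opI [of i j p "q - 1" r] True le
        by (metis mseg_le_def r_into_rtranclp)
    next
      case False
      \<comment> \<open>The truncated segment now ends where \<open>[i,j]\<close> does, and the two multisegments coincide.\<close>
      then have "q - 1 = j" using le by simp
      then show ?thesis by (simp add: mseg_le_def)
    qed
    then show ?thesis using sub unfolding new by (metis old)
  next
    case 2
    have sub: "{#{i..j}#} \<subseteq># ending_at {#{i..j}, {p..q}#} k"
      using 2 le by (simp add: ending_at_def)
    have new: "truncate (discard_empty {#{i..q}, {p..j}#}) H
        = discard_empty {#{i..q}, {p..j - 1}#}"
      using 2 le by (auto simp: truncate_def)
    have old: "truncate {#{i..j}, {p..q}#} {#{i..j}#} = {#{i..j - 1}, {p..q}#}"
      using 2 le by (auto simp: truncate_def)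
    have "mseg_le (r + discard_empty {#{i..q}, {p..j - 1}#}) (r + {#{i..j - 1}, {p..q}#})" for r
      unfolding mseg_le_def by (rule r_into_rtranclp, rule elementary_opI) (use le 2 in auto)
    then show ?thesis using sub unfolding new by (metis old)
  qed
qed

lemma truncate_elementary_op:
  assumes "elementary_op b a" and G: "G \<subseteq># ending_at b k"
  shows "\<exists>G'. G' \<subseteq># ending_at a k \<and> mseg_le (truncate b G) (truncate a G')"
proof -
  from assms(1) obtain r i j p q where le: "i \<le> j" "i < p" "p \<le> j + 1" "j < q"
    and a: "a = r + {#{i..j}, {p..q}#}" and b: "b = r + discard_empty {#{i..q}, {p..j}#}"
    by (rule elementary_op_cases)
  from G obtain R H where GRH: "G = R + H" and R: "R \<subseteq># ending_at r k"
    and H: "H \<subseteq># ending_at (discard_empty {#{i..q}, {p..j}#}) k"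
    unfolding b ending_at_union by (rule subset_mset_unionE)
  obtain H' where H': "H' \<subseteq># ending_at {#{i..j}, {p..q}#} k"
    and ex: "\<And>r. mseg_le (r + truncate (discard_empty {#{i..q}, {p..j}#}) H)
                 (r + truncate {#{i..j}, {p..q}#} H')"
    using truncate_exchange [OF le H] by blast
  have "R + H' \<subseteq># ending_at a k"
    unfolding a ending_at_union by (rule subset_mset.add_mono [OF R H'])
  moreover have "truncate b G = truncate r R + truncate (discard_empty {#{i..q}, {p..j}#}) H"
    unfolding b GRH by (rule truncate_union) (use R H in \<open>simp_all add: subset_ending_at_iff\<close>)
  moreover have "truncate a (R + H') = truncate r R + truncate {#{i..j}, {p..q}#} H'"
    unfolding a by (rule truncate_union) (use R H' in \<open>simp_all add: subset_ending_at_iff\<close>)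
  ultimately show ?thesis using ex by metis
qed

lemma truncate_mseg_le:
  assumes "mseg_le b a" and "G \<subseteq># ending_at b k"
  shows "\<exists>G'. G' \<subseteq># ending_at a k \<and> mseg_le (truncate b G) (truncate a G')"
  using assms(1)[unfolded mseg_le_def]
proof (induction rule: rtranclp_induct)
  case base
  then show ?case using assms(2) by (auto simp: mseg_le_def)
next
  case (step c d)
  then obtain G' where G': "G' \<subseteq># ending_at c k" "mseg_le (truncate b G) (truncate c G')" by blast
  obtain G'' where "G'' \<subseteq># ending_at d k" "mseg_le (truncate c G') (truncate d G'')"
    using truncate_elementary_op [OF step.hyps(2) G'(1)] by blast
  then show ?case using G'(2) unfolding mseg_le_def by (meson rtranclp_trans)
qed

lemma trunc_le_refl: "trunc_le k a a"
  unfolding trunc_le_def by (intro exI [of _ "{#}"]) (simp add: mseg_le_def)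

lemma trunc_le_trans:
  assumes "trunc_le k c b" "trunc_le k b a"
  shows "trunc_le k c a"
proof -
  obtain H where H: "H \<subseteq># ending_at b k" "mseg_le c (truncate b H)"
    using assms(1) unfolding trunc_le_def by blast
  obtain G where G: "G \<subseteq># ending_at a k" "mseg_le b (truncate a G)"
    using assms(2) unfolding trunc_le_def by blast
  obtain H' where H': "H' \<subseteq># ending_at (truncate a G) k"
    "mseg_le (truncate b H) (truncate (truncate a G) H')"
    using truncate_mseg_le [OF G(2) H(1)] by blast
  have "mseg_le c (truncate a (G + H'))"
    using H(2) H'(2) unfolding truncate_truncate(2) [OF G(1) H'(1)] mseg_le_def
    by (rule rtranclp_trans)
  then show ?thesis using truncate_truncate(1) [OF G(1) H'(1)] unfolding trunc_le_def by blast
qed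

section \<open>Antisymmetry\<close>

lemma sum_discard_empty:
  fixes f :: "int set \<Rightarrow> 'a::comm_monoid_add"
  assumes "f {} = 0"
  shows "(\<Sum>D\<in>#discard_empty a. f D) = (\<Sum>D\<in>#a. f D)"
  by (induction a) (auto simp: assms)

lemma elementary_op_sum_card:
  assumes "elementary_op b a"
  shows "(\<Sum>D\<in>#b. card D) = (\<Sum>D\<in>#a. card D)"
  using assms by (rule elementary_op_cases) (auto simp: sum_discard_empty)

lemma mseg_le_sum_card:
  assumes "mseg_le b a"
  shows "(\<Sum>D\<in>#b. card D) = (\<Sum>D\<in>#a. card D)"
  using assms[unfolded mseg_le_def]
  by (induction rule: rtranclp_induct) (auto simp: elementary_op_sum_card)

text \<open>An operation preserves the sum of the two lengths involved (an empty segment counting as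
  length \<open>0\<close>) but moves them further apart, which increases the sum of their squares.\<close>

lemma elementary_op_sum_card_squares:
  assumes "elementary_op b a"
  shows "(\<Sum>D\<in>#a. (card D)\<^sup>2) < (\<Sum>D\<in>#b. (card D)\<^sup>2)"
proof -
  from assms obtain r i j p q where le: "i \<le> j" "i < p" "p \<le> j + 1" "j < q"
    and a: "a = r + {#{i..j}, {p..q}#}" and b: "b = r + discard_empty {#{i..q}, {p..j}#}"
    by (rule elementary_op_cases)
  \<comment> \<open>The overlap, possibly empty, has length \<open>m\<close>; \<open>x\<close> and \<open>y\<close> are the lengths of the two
    parts covered by only one of the segments.\<close>
  define x y m where "x = nat (p - i)" and "y = nat (q - j)" and "m = nat (j + 1 - p)"
  have card: "card {i..j} = m + x" "card {p..q} = m + y" "card {i..q} = m + x + y" "card {p..j} = m"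
    using le by (auto simp: x_def y_def m_def)
  have "0 < x * y" using le by (simp add: x_def y_def)
  then have "(m + x)\<^sup>2 + (m + y)\<^sup>2 < (m + x + y)\<^sup>2 + m\<^sup>2"
    by (simp add: power2_eq_square algebra_simps)
  then show ?thesis unfolding a b
    by (simp add: sum_discard_empty card del: discard_empty_add_mset card_atLeastAtMost_int)
qed

lemma mseg_le_imp_eq_or_sum_card_squares:
  assumes "mseg_le b a"
  shows "b = a \<or> (\<Sum>D\<in>#a. (card D)\<^sup>2) < (\<Sum>D\<in>#b. (card D)\<^sup>2)"
  using assms[unfolded mseg_le_def]
  by (induction rule: rtranclp_induct) (use elementary_op_sum_card_squares in \<open>fastforce+\<close>)

lemma mseg_le_antisym: "mseg_le b a \<Longrightarrow> mseg_le a b \<Longrightarrow> b = a"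
  using mseg_le_imp_eq_or_sum_card_squares [of b a] mseg_le_imp_eq_or_sum_card_squares [of a b]
  by auto

lemma sum_card_truncate:
  assumes "a \<in> multisegments" "G \<subseteq># a"
  shows "(\<Sum>D\<in>#truncate a G. card D) + size G = (\<Sum>D\<in>#a. card D)"
proof -
  have seg: "\<forall>D\<in>#G. is_segment D"
    using assms unfolding multisegments_def by (auto dest: mset_subset_eqD)
  have "(\<Sum>D\<in>#G. card (shorten D)) + size G = (\<Sum>D\<in>#G. card D)"
    using seg by (induction G) (auto simp: is_segment_def)
  moreover obtain c where "a = G + c" using assms(2) by (auto simp: mset_subset_eq_exists_conv)
  ultimately show ?thesis by (simp add: truncate_def sum_discard_empty multiset.map_comp comp_def)
qed

lemma trunc_le_sum_card:
  assumes "a \<in> multisegments" "trunc_le k b a"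
  shows "(\<Sum>D\<in>#b. card D) < (\<Sum>D\<in>#a. card D) \<or>
    (\<Sum>D\<in>#b. card D) = (\<Sum>D\<in>#a. card D) \<and> mseg_le b a"
proof -
  obtain G where G: "G \<subseteq># ending_at a k" "mseg_le b (truncate a G)"
    using assms(2) unfolding trunc_le_def by blast
  have sum: "(\<Sum>D\<in>#b. card D) + size G = (\<Sum>D\<in>#a. card D)"
    using sum_card_truncate [OF assms(1), of G] G mseg_le_sum_card [OF G(2)]
    by (simp add: subset_ending_at_iff)
  show ?thesis
  proof (cases "G = {#}")
    case True
    then show ?thesis using sum G(2) by simp
  next
    case False
    then show ?thesis using sum by (simp add: nonempty_has_size)
  qed
qed

lemma trunc_le_antisym:
  assumes "a \<in> multisegments" "b \<in> multisegments" "trunc_le k b a" "trunc_le k a b"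
  shows "b = a"
  using trunc_le_sum_card [OF assms(1,3)] trunc_le_sum_card [OF assms(2,4)] mseg_le_antisym
  by auto

theorem proposition7p1p8:
  fixes k :: int
  shows "partial_order_on multisegments
    {(b, a). b \<in> multisegments \<and> a \<in> multisegments \<and> trunc_le k b a}"
proof -
  let ?R = "{(b, a). b \<in> multisegments \<and> a \<in> multisegments \<and> trunc_le k b a}"
  have "?R \<subseteq> multisegments \<times> multisegments" by blast
  moreover have "refl_on multisegments ?R" by (auto simp: refl_on_def trunc_le_refl)
  moreover have "trans ?R" by (auto intro!: transI intro: trunc_le_trans)
  moreover have "antisym ?R" by (auto intro!: antisymI intro: trunc_le_antisym)
  ultimately show ?thesis by (simp add: partial_order_on_def preorder_on_def)
qed

end
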